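(* Let $k$ be a field of characteristic $0$. The variety of transposed Poisson algebras over $k$ coincides with the variety of commutative Gelfand--Dorfman algebras over $k$. That is, a $k$-vector space $A$ with two bilinear operations $\circ$ and $[\cdot,\cdot]$ is a Gelfand--Dorfman algebra whose Novikov multiplication $\circ$ is commutative if and only if $(A,\circ,[\cdot,\cdot])$ is a transposed Poisson algebra.
   Context: All algebras are over a field of characteristic $0$. A Novikov algebra is a vector space $A$ with a bilinear product $\circ$ satisfying, for all $x_1,x_2,x_3\in A$, $$(x_1\circ x_2)\circ x_3-x_1\circ(x_2\circ x_3)=(x_2\circ x_1)\circ x_3-x_2\circ(x_1\circ x_3),\qquad (x_1\circ x_2)\circ x_3=(x_1\circ x_3)\circ x_2.$$ A Gelfand--Dorfman algebra is a vector space $V$ with two bilinear operations $\circ$ and $[\cdot,\cdot]$ such that $(V,\circ)$ is a Novikov algebra, $(V,[\cdot,\cdot])$ is a Lie algebra, and for all $x_1,x_2,x_3\in V$ $$[x_1,x_2\circ x_3]-[x_3,x_2\circ x_1]+[x_2,x_1]\circ x_3-[x_2,x_3]\circ x_1-x_2\circ [x_1,x_3]=0.$$ It is called commutative if in addition $x_1\circ x_2=x_2\circ x_1$ for all $x_1,x_2$. A transposed Poisson algebra is a vector space with two bilinear operations, a commutative associative product (written $\circ$ or by juxtaposition) and a Lie bracket $[\cdot,\cdot]$, satisfying for all $x_1,x_2,x_3$ $$2[x_1,x_2]x_3=[x_1x_3,x_2]+[x_1,x_2x_3].$$ *)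

theory Defs
  imports Complex_Main
begin

text \<open>
  All algebras live on a whole type \<open>'v\<close> with scalars in a field \<open>'k\<close> of characteristic 0.
  The circle product of the literature is written \<open>\<cdot>\<close> (the circle denotes function composition in HOL).
\<close>

locale bilinear_operation = vector_space scale
  for scale :: "'k::field_char_0 \<Rightarrow> 'v::ab_group_add \<Rightarrow> 'v" +
  fixes opn :: "'v \<Rightarrow> 'v \<Rightarrow> 'v"
  assumes linear_left: "Vector_Spaces.linear scale scale (\<lambda>x. opn x y)"
    and linear_right: "Vector_Spaces.linear scale scale (\<lambda>y. opn x y)"

locale novikov_algebra = bilinear_operation scale mult
  for scale :: "'k::field_char_0 \<Rightarrow> 'v::ab_group_add \<Rightarrow> 'v"
    and mult :: "'v \<Rightarrow> 'v \<Rightarrow> 'v"  (infixl \<open>\<cdot>\<close> 70) +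
  assumes left_symmetric:
      "(x1 \<cdot> x2) \<cdot> x3 - x1 \<cdot> (x2 \<cdot> x3) = (x2 \<cdot> x1) \<cdot> x3 - x2 \<cdot> (x1 \<cdot> x3)"
    and right_commutative: "(x1 \<cdot> x2) \<cdot> x3 = (x1 \<cdot> x3) \<cdot> x2"

locale lie_algebra = lie: bilinear_operation scale lie
  for scale :: "'k::field_char_0 \<Rightarrow> 'v::ab_group_add \<Rightarrow> 'v"
    and lie :: "'v \<Rightarrow> 'v \<Rightarrow> 'v" +
  assumes alternating: "lie x x = 0"
    and jacobi: "lie x (lie y z) + lie y (lie z x) + lie z (lie x y) = 0"

locale gelfand_dorfman_algebra = novikov_algebra scale mult + lie_algebra scale lie
  for scale :: "'k::field_char_0 \<Rightarrow> 'v::ab_group_add \<Rightarrow> 'v"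
    and mult :: "'v \<Rightarrow> 'v \<Rightarrow> 'v"  (infixl \<open>\<cdot>\<close> 70)
    and lie :: "'v \<Rightarrow> 'v \<Rightarrow> 'v" +
  assumes gelfand_dorfman:
    "lie x1 (x2 \<cdot> x3) - lie x3 (x2 \<cdot> x1) + lie x2 x1 \<cdot> x3 - lie x2 x3 \<cdot> x1 - x2 \<cdot> lie x1 x3 = 0"

locale commutative_gelfand_dorfman_algebra = gelfand_dorfman_algebra scale mult lie
  for scale :: "'k::field_char_0 \<Rightarrow> 'v::ab_group_add \<Rightarrow> 'v"
    and mult :: "'v \<Rightarrow> 'v \<Rightarrow> 'v"  (infixl \<open>\<cdot>\<close> 70)
    and lie :: "'v \<Rightarrow> 'v \<Rightarrow> 'v" +
  assumes commutative: "x1 \<cdot> x2 = x2 \<cdot> x1"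

locale transposed_poisson_algebra =
  bilinear_operation scale mult + lie_algebra scale lie
  for scale :: "'k::field_char_0 \<Rightarrow> 'v::ab_group_add \<Rightarrow> 'v"
    and mult :: "'v \<Rightarrow> 'v \<Rightarrow> 'v"  (infixl \<open>\<cdot>\<close> 70)
    and lie :: "'v \<Rightarrow> 'v \<Rightarrow> 'v" +
  assumes commutative: "x1 \<cdot> x2 = x2 \<cdot> x1"
    and associative: "(x1 \<cdot> x2) \<cdot> x3 = x1 \<cdot> (x2 \<cdot> x3)"
    and transposed_leibniz:
      "scale 2 (lie x1 x2 \<cdot> x3) = lie (x1 \<cdot> x3) x2 + lie x1 (x2 \<cdot> x3)"

end

theory Submission
  imports Defs
begin

text \<open>
  For a commutative product, each of the Novikov axioms is a form of associativity, so only the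
  compatibility conditions have to be compared. Put
  \<open>u i = [x i, x j x k]\<close> with \<open>{i, j, k} = {1, 2, 3}\<close>, and let \<open>a\<close>, \<open>b\<close>, \<open>c\<close> be
  \<open>[x1, x2] x3\<close>, \<open>[x2, x3] x1\<close>, \<open>[x3, x1] x2\<close>. The Gelfand-Dorfman identity reads
  \<open>u 1 - u 3 = a + b - c\<close>, and the transposed Leibniz rule reads \<open>u 1 - u 3 = - 2 c\<close>.
  These two equations differ by \<open>a + b + c = 0\<close>. The left-hand side \<open>u 1 - u 3\<close> has cyclic
  sum zero, whereas the two right-hand sides have cyclic sums \<open>a + b + c\<close> and
  \<open>- 2 (a + b + c)\<close>. Hence either identity forces \<open>a + b + c = 0\<close> (the second because 2 is
  invertible), and then it implies the other. The lemmas \<open>cyclic_sum_zero\<close> of the two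
  locales below carry this argument.
\<close>

context bilinear_operation
begin

lemma opn_minus_left: "opn (- x) y = - opn x y"
  by (rule module_hom.neg[OF module_hom_linearI[OF linear_left]])

lemma opn_add_left: "opn (x + z) y = opn x y + opn z y"
  by (rule module_hom.add[OF module_hom_linearI[OF linear_left]])

lemma opn_add_right: "opn x (y + z) = opn x y + opn x z"
  by (rule module_hom.add[OF module_hom_linearI[OF linear_right]])

lemma scale_two: "scale 2 v = v + v"
  using scale_left_distrib[of 1 1 v] by simp

lemma double_eq_zero:
  fixes v :: 'v
  assumes "v + v = 0"
  shows "v = 0"
  using assms scale_two[of v] by simp

end

lemma (in lie_algebra) antisymmetric: "lie x y = - lie y x"
proof -
  have "0 = lie (x + y) (x + y)"
    by (simp add: alternating)
  also have "\<dots> = lie x y + lie y x"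
    unfolding lie.opn_add_left lie.opn_add_right by (simp add: alternating)
  finally show ?thesis
    by (simp add: eq_neg_iff_add_eq_0)
qed

context commutative_gelfand_dorfman_algebra
begin

lemma associative: "(x \<cdot> y) \<cdot> z = x \<cdot> (y \<cdot> z)"
  using right_commutative[of y x z] by (simp add: commutative)

lemma gelfand_dorfman_cyclic:
  "lie x (y \<cdot> z) - lie z (x \<cdot> y) = lie x y \<cdot> z + lie y z \<cdot> x - lie z x \<cdot> y"
  using gelfand_dorfman[of x y z] antisymmetric[of y x] antisymmetric[of x z]
  by (simp add: commutative[of y x] commutative[of y "- lie z x"] opn_minus_left algebra_simps)

text \<open>
  Adding the three rotations of the previous identity, the left-hand sides telescope; on the right
  each product occurs twice with sign plus and once with sign minus.
\<close>

lemma cyclic_sum_zero: "lie x y \<cdot> z + lie y z \<cdot> x + lie z x \<cdot> y = 0"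
proof -
  let ?u = "lie x (y \<cdot> z)" and ?v = "lie y (z \<cdot> x)" and ?w = "lie z (x \<cdot> y)"
  let ?a = "lie x y \<cdot> z" and ?b = "lie y z \<cdot> x" and ?c = "lie z x \<cdot> y"
  have "?a + ?b + ?c = (?a + ?b - ?c) + (?b + ?c - ?a) + (?c + ?a - ?b)"
    by (simp add: algebra_simps)
  also have "\<dots> = (?u - ?w) + (?v - ?u) + (?w - ?v)"
    by (simp only: gelfand_dorfman_cyclic)
  finally show ?thesis
    by simp
qed

lemma transposed_leibniz:
  "scale 2 (lie x y \<cdot> z) = lie (x \<cdot> z) y + lie x (y \<cdot> z)"
proof -
  have "lie (x \<cdot> z) y + lie x (y \<cdot> z) = lie x (z \<cdot> y) - lie y (x \<cdot> z)"
    using antisymmetric[of "x \<cdot> z" y] by (simp add: commutative[of z y])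
  also have "\<dots> = lie x z \<cdot> y + lie z y \<cdot> x - lie y x \<cdot> z"
    by (rule gelfand_dorfman_cyclic)
  also have "\<dots> = - lie y x \<cdot> z - lie y x \<cdot> z"
    using cyclic_sum_zero[of x z y] by (simp add: opn_minus_left add_eq_0_iff2)
  also have "\<dots> = scale 2 (lie x y \<cdot> z)"
    using antisymmetric[of x y] by (simp add: scale_two opn_minus_left)
  finally show ?thesis
    by simp
qed

end

context transposed_poisson_algebra
begin

lemma transposed_leibniz_cyclic:
  "lie z x \<cdot> y + lie z x \<cdot> y = lie z (x \<cdot> y) - lie x (y \<cdot> z)"
  using transposed_leibniz[of z x y] antisymmetric[of "z \<cdot> y" x]
  by (simp add: scale_two commutative[of z y])

text \<open>
  Here the rotations telescope against twice the cyclic sum, so this direction divides by 2.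
\<close>

lemma cyclic_sum_zero: "lie x y \<cdot> z + lie y z \<cdot> x + lie z x \<cdot> y = 0"
proof (rule double_eq_zero)
  let ?a = "lie x y \<cdot> z" and ?b = "lie y z \<cdot> x" and ?c = "lie z x \<cdot> y"
  let ?u = "lie x (y \<cdot> z)" and ?v = "lie y (z \<cdot> x)" and ?w = "lie z (x \<cdot> y)"
  have "?a + ?b + ?c + (?a + ?b + ?c) = (?a + ?a) + (?b + ?b) + (?c + ?c)"
    by (simp add: algebra_simps)
  also have "\<dots> = (?u - ?v) + (?v - ?w) + (?w - ?u)"
    by (simp only: transposed_leibniz_cyclic)
  finally show "?a + ?b + ?c + (?a + ?b + ?c) = 0"
    by simp
qed

lemma gelfand_dorfman:
  "lie x (y \<cdot> z) - lie z (y \<cdot> x) + lie y x \<cdot> z - lie y z \<cdot> x - y \<cdot> lie x z = 0"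
proof -
  have "lie x (y \<cdot> z) - lie z (y \<cdot> x) = - (lie z x \<cdot> y + lie z x \<cdot> y)"
    using transposed_leibniz_cyclic[of z x y] by (simp add: commutative[of y x])
  moreover have "lie y x \<cdot> z = - (lie x y \<cdot> z)"
    using antisymmetric[of y x] by (simp add: opn_minus_left)
  moreover have "y \<cdot> lie x z = - (lie z x \<cdot> y)"
    using antisymmetric[of x z] by (simp add: commutative[of y "- lie z x"] opn_minus_left)
  ultimately have "lie x (y \<cdot> z) - lie z (y \<cdot> x) + lie y x \<cdot> z - lie y z \<cdot> x - y \<cdot> lie x z
      = - (lie x y \<cdot> z + lie y z \<cdot> x + lie z x \<cdot> y)"
    by (simp add: algebra_simps)
  then show ?thesis
    by (simp add: cyclic_sum_zero)
qed

lemma right_commutative: "(x \<cdot> y) \<cdot> z = (x \<cdot> z) \<cdot> y"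
  by (simp add: associative commutative[of y z])

lemma left_symmetric:
  "(x \<cdot> y) \<cdot> z - x \<cdot> (y \<cdot> z) = (y \<cdot> x) \<cdot> z - y \<cdot> (x \<cdot> z)"
  by (simp add: associative)

end

theorem mainTheorem1:
  fixes scale :: "'k::field_char_0 \<Rightarrow> 'v::ab_group_add \<Rightarrow> 'v"
    and mult lie :: "'v \<Rightarrow> 'v \<Rightarrow> 'v"
  shows "commutative_gelfand_dorfman_algebra scale mult lie \<longleftrightarrow>
         transposed_poisson_algebra scale mult lie"
proof
  assume "commutative_gelfand_dorfman_algebra scale mult lie"
  then interpret commutative_gelfand_dorfman_algebra scale mult lie .
  show "transposed_poisson_algebra scale mult lie"
    by unfold_locales (fact commutative associative transposed_leibniz)+
next
  assume "transposed_poisson_algebra scale mult lie"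
  then interpret transposed_poisson_algebra scale mult lie .
  show "commutative_gelfand_dorfman_algebra scale mult lie"
    by unfold_locales (fact left_symmetric right_commutative gelfand_dorfman commutative)+
qed

end
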